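(* Let $E$ be a finite set with $|E|\ge2$, let $K\subseteq\mathbb R_+^E$ be a rational polyhedral cone and let $P=K\cap[0,1]^E$. Assume that $P$ is integral, that is, $P=\operatorname{conv}(P\cap\{0,1\}^E)$. Let $c\in\mathbb R^E$ with $\alpha=\max\{c^\top y:y\in P\}>0$, let $F=\{y\in P:c^\top y=\alpha\}$ and $I=\bigcap_{y\in F}\operatorname{supp}(y)$. Let $\mathcal U$ be the set of optimal solutions of $$\min\{\mathbf1^\top u:\ u\ge0,\ u-c\in K^*\}.$$ Then $I=\bigcup_{u\in\mathcal U}\operatorname{supp}(u)$.
   Context: For $y\in\mathbb R_+^E$, $\operatorname{supp}(y)=\{e\in E:y_e>0\}$. $K^*=\{s\in\mathbb R^E:s^\top x\ge0\ \forall x\in K\}$ is the dual cone. *)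

theory Defs
  imports "HOL-Analysis.Analysis"
begin

(* The finite ground set E is the index type 'e; vectors in R^E are real ^ 'e. *)

(* The cones {x. A x >= 0} for a rational matrix A; the finite set S holds the rows of A. *)
definition rational_polyhedral_cone :: "(real ^ 'e) set \<Rightarrow> bool" where
  "rational_polyhedral_cone K \<longleftrightarrow>
     (\<exists>S. finite S \<and> (\<forall>a\<in>S. \<forall>e. a $ e \<in> \<rat>) \<and> K = {x. \<forall>a\<in>S. 0 \<le> a \<bullet> x})"

definition dual_cone :: "(real ^ 'e) set \<Rightarrow> (real ^ 'e) set" where
  "dual_cone K = {s. \<forall>x\<in>K. 0 \<le> s \<bullet> x}"

(* Only meant for nonnegative vectors. *)
definition supp :: "real ^ 'e \<Rightarrow> 'e set" where
  "supp y = {e. 0 < y $ e}"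

definition nonneg_orthant :: "(real ^ 'e) set" where
  "nonneg_orthant = {x. \<forall>e. 0 \<le> x $ e}"

definition unit_cube :: "(real ^ 'e) set" where
  "unit_cube = {x. \<forall>e. 0 \<le> x $ e \<and> x $ e \<le> 1}"

definition zero_one_vectors :: "(real ^ 'e) set" where
  "zero_one_vectors = {x. \<forall>e. x $ e \<in> {0, 1}}"

definition dual_feasible :: "(real ^ 'e) set \<Rightarrow> real ^ 'e \<Rightarrow> (real ^ 'e) set" where
  "dual_feasible K c = {u. u \<in> nonneg_orthant \<and> u - c \<in> dual_cone K}"

definition dual_optimal :: "(real ^ 'e) set \<Rightarrow> real ^ 'e \<Rightarrow> (real ^ 'e) set" where
  "dual_optimal K c =
     {u \<in> dual_feasible K c. \<forall>v\<in>dual_feasible K c. (\<Sum>e\<in>UNIV. u $ e) \<le> (\<Sum>e\<in>UNIV. v $ e)}"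

end

theory Submission
  imports Defs
begin

text \<open>
  The minimisation problem is the linear programming dual of maximising \<open>c\<close> over the part of \<open>K\<close>
  below the all-ones vector: the variable \<open>u $ e\<close> prices the constraint \<open>y $ e \<le> 1\<close>, and the sign
  constraints on \<open>y\<close> are already implied by membership in \<open>K\<close>.  So the optimal dual value is
  \<open>\<alpha>\<close> (\<open>weak_duality\<close> and \<open>strong_duality\<close>), and the theorem is a statement about complementary
  slackness.

  If \<open>u\<close> is dual optimal and \<open>0 < u $ e\<close>, then every \<open>y\<close> in the optimal face \<open>F\<close> has
  \<open>y $ e = 1\<close>, so \<open>e\<close> lies in its support.

  Conversely, let \<open>e\<close> lie in the support of every point of \<open>F\<close>.  Then every 0/1 point of \<open>P\<close> either
  has coordinate \<open>e\<close> equal to 1 or has positive optimality gap \<open>\<alpha> - c \<bullet> y\<close>.  There are finitely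
  many such points, so for some \<open>\<lambda> > 0\<close> all of them satisfy
  \<open>1 - y $ e \<le> \<lambda> * (\<alpha> - c \<bullet> y)\<close>; the inequality is affine in \<open>y\<close>, so it passes to their convex
  hull \<open>P\<close>.  It bounds the objective \<open>\<lambda> *\<^sub>R c - axis e 1\<close> on \<open>P\<close> by \<open>\<lambda> * \<alpha> - 1\<close>.  A dual
  certificate \<open>w\<close> of this bound becomes, after adding \<open>axis e 1\<close> and dividing by \<open>\<lambda>\<close>, a dual
  optimal solution for \<open>c\<close> that is positive at \<open>e\<close>.
\<close>

lemma inner_sum_coordinates: "x \<bullet> y = (\<Sum>e\<in>UNIV. x $ e * y $ e)"
  for x y :: "real ^ 'e"
  by (simp add: inner_vec_def)

lemma weak_duality:
  fixes u y :: "real ^ 'e"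
  assumes u: "u \<in> dual_feasible K c" and y: "y \<in> K \<inter> unit_cube"
  shows "c \<bullet> y \<le> u \<bullet> y" and "u \<bullet> y \<le> (\<Sum>e\<in>UNIV. u $ e)"
proof -
  have "0 \<le> (u - c) \<bullet> y"
    using u y by (auto simp: dual_feasible_def dual_cone_def)
  then show "c \<bullet> y \<le> u \<bullet> y"
    by (simp add: inner_diff_left)
  show "u \<bullet> y \<le> (\<Sum>e\<in>UNIV. u $ e)"
    unfolding inner_sum_coordinates
  proof (rule sum_mono)
    fix e
    show "u $ e * y $ e \<le> u $ e"
      using u y
      by (intro mult_left_le) (auto simp: dual_feasible_def nonneg_orthant_def unit_cube_def)
  qed
qed

text \<open>
  The vectors \<open>u - s\<close> with \<open>u\<close> in the simplex of nonnegative vectors of sum at most \<open>\<beta>\<close> and \<open>s\<close> in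
  the dual cone form a closed convex set, because the simplex is compact.  If \<open>q\<close> were outside,
  a separating normal \<open>y\<close> would lie in the bidual of \<open>K\<close>, which is \<open>K\<close> since the defining vectors
  of \<open>K\<close> belong to the dual cone.  Testing \<open>y\<close> against the vertex of the simplex at the largest
  coordinate of \<open>y\<close> shows that \<open>y\<close>, scaled to have maximum 1, violates the bound \<open>\<beta>\<close>.
\<close>
lemma strong_duality:
  fixes K :: "(real ^ 'e) set" and q :: "real ^ 'e"
  assumes K: "K = {x. \<forall>a\<in>S. 0 \<le> a \<bullet> x}" and nonneg: "K \<subseteq> nonneg_orthant"
    and bound: "\<And>y. y \<in> K \<inter> unit_cube \<Longrightarrow> q \<bullet> y \<le> \<beta>"
  shows "\<exists>u\<in>dual_feasible K q. (\<Sum>e\<in>UNIV. u $ e) \<le> \<beta>"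
proof -
  define U :: "(real ^ 'e) set" where
    "U = nonneg_orthant \<inter> {u. (\<Sum>e\<in>UNIV. u $ e) \<le> \<beta>}"
  define T where "T = {u - s | u s. u \<in> U \<and> s \<in> dual_cone K}"
  have \<beta>: "0 \<le> \<beta>"
    using bound[of 0] by (auto simp: K unit_cube_def)
  have closed_orthant: "closed (nonneg_orthant :: (real ^ 'e) set)"
    unfolding nonneg_orthant_def
    by (intro closed_Collect_all closed_Collect_le continuous_intros)
  have "closed U"
    unfolding U_def
    by (intro closed_Int closed_orthant closed_Collect_le continuous_intros)
  moreover have "U \<subseteq> cball 0 \<beta>"
  proof
    fix u assume "u \<in> U"
    then have "norm u \<le> \<beta>"
      using norm_le_l1_cart[of u] by (simp add: U_def nonneg_orthant_def)
    then show "u \<in> cball 0 \<beta>" by simp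
  qed
  ultimately have compact_U: "compact U"
    using bounded_cball bounded_subset compact_eq_bounded_closed by blast
  have convex_U: "convex U"
    unfolding U_def
  proof (rule convex_Int)
    show "convex (nonneg_orthant :: (real ^ 'e) set)"
      by (auto simp: nonneg_orthant_def convex_def)
    have "{u :: real ^ 'e. (\<Sum>e\<in>UNIV. u $ e) \<le> \<beta>} = {u. 1 \<bullet> u \<le> \<beta>}"
      by (simp add: inner_sum_coordinates)
    then show "convex {u :: real ^ 'e. (\<Sum>e\<in>UNIV. u $ e) \<le> \<beta>}"
      by (simp add: convex_halfspace_le)
  qed
  have dual: "dual_cone K = (\<Inter>x\<in>K. {s. 0 \<le> s \<bullet> x})"
    by (auto simp: dual_cone_def)
  have closed_dual: "closed (dual_cone K)"
    unfolding dual by (intro closed_INT ballI closed_Collect_le continuous_intros)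
  have convex_dual: "convex (dual_cone K)"
    by (auto simp: dual_cone_def convex_def inner_add_left)
  have T_eq: "T = (\<Union>u\<in>U. \<Union>s\<in>dual_cone K. {u - s})"
    by (auto simp: T_def)
  have closed_T: "closed T"
    unfolding T_eq by (rule compact_closed_differences[OF compact_U closed_dual])
  have convex_T: "convex T"
    unfolding T_eq by (rule convex_differences[OF convex_U convex_dual])
  have "q \<in> T"
  proof (rule ccontr)
    assume "q \<notin> T"
    then obtain a b where sep: "a \<bullet> q < b" "\<And>x. x \<in> T \<Longrightarrow> b < a \<bullet> x"
      using separating_hyperplane_closed_point[OF convex_T closed_T] by blast
    define y where "y = - a"
    have zero_U: "0 \<in> U"
      using \<beta> by (simp add: U_def nonneg_orthant_def)
    have "0 \<in> T"
      using zero_U by (force simp: T_def dual_cone_def)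
    then have b: "b < 0"
      using sep(2) by force
    have bidual: "0 \<le> s \<bullet> y" if s: "s \<in> dual_cone K" for s
    proof (rule ccontr)
      assume "\<not> 0 \<le> s \<bullet> y"
      then have neg: "s \<bullet> y < 0" by simp
      \<comment> \<open>this multiple of \<open>s\<close> puts \<open>- k *\<^sub>R s\<close>, a point of \<open>T\<close>, on the separating hyperplane\<close>
      define k where "k = b / (s \<bullet> y)"
      have "k > 0" using neg b by (simp add: k_def divide_neg_neg)
      then have "k *\<^sub>R s \<in> dual_cone K"
        using s by (auto simp: dual_cone_def)
      then have "0 - k *\<^sub>R s \<in> T"
        using zero_U unfolding T_def by blast
      from sep(2)[OF this] show False
        using neg by (simp add: y_def k_def inner_commute)
    qed
    have "y \<in> K"
      unfolding K
    proof (intro CollectI ballI)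
      fix d assume "d \<in> S"
      then have "d \<in> dual_cone K"
        by (simp add: dual_cone_def K)
      then show "0 \<le> d \<bullet> y" by (rule bidual)
    qed
    then have y_nonneg: "0 \<le> y $ e" for e
      using nonneg by (auto simp: nonneg_orthant_def)
    define m where "m = Max (range (\<lambda>e. y $ e))"
    have y_le: "y $ e \<le> m" for e
      by (simp add: m_def)
    have "m \<in> range (\<lambda>e. y $ e)"
      unfolding m_def by (rule Max_in) auto
    then obtain f where f: "y $ f = m" by force
    have "y \<noteq> 0"
      using b sep(1) by (auto simp: y_def)
    then have "m \<noteq> 0"
      using y_le y_nonneg by (metis order_antisym vec_eq_iff zero_index)
    then have m: "m > 0"
      using f y_nonneg[of f] by simp
    have "(1 / m) *\<^sub>R y \<in> K \<inter> unit_cube"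
      using \<open>y \<in> K\<close> m y_nonneg y_le by (auto simp: K unit_cube_def)
    from bound[OF this] have upper: "q \<bullet> y \<le> \<beta> * m"
      using m by (simp add: field_simps)
    have "axis f \<beta> \<in> U"
      using \<beta> by (simp add: U_def nonneg_orthant_def axis_def)
    then have "axis f \<beta> - 0 \<in> T"
      unfolding T_def by (force simp: dual_cone_def)
    from sep(2)[OF this] sep(1) have "y \<bullet> axis f \<beta> < y \<bullet> q"
      by (simp add: y_def)
    then have "\<beta> * m < q \<bullet> y"
      using f by (simp add: inner_axis inner_commute mult.commute)
    with upper show False by simp
  qed
  then obtain u s where us: "q = u - s" "u \<in> U" "s \<in> dual_cone K"
    by (auto simp: T_def)
  then have "u - q = s" by simp
  with us show ?thesis
    by (auto simp: U_def dual_feasible_def)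
qed

lemma finite_zero_one_vectors: "finite (zero_one_vectors :: (real ^ 'e) set)"
proof (rule finite_subset)
  show "zero_one_vectors \<subseteq> (\<lambda>A. (\<chi> e. if e \<in> A then 1 else 0) :: real ^ 'e) ` (UNIV :: 'e set set)"
  proof
    fix x :: "real ^ 'e" assume "x \<in> zero_one_vectors"
    then have "x = (\<chi> e. if e \<in> {e. x $ e = 1} then 1 else 0)"
      by (auto simp: zero_one_vectors_def vec_eq_iff)
    then show "x \<in> (\<lambda>A. (\<chi> e. if e \<in> A then 1 else 0) :: real ^ 'e) ` (UNIV :: 'e set set)"
      by blast
  qed
qed simp

text \<open>
  On a finite set, a function that is positive only where \<open>g\<close> is positive is dominated by a
  multiple of \<open>g\<close>.  With \<open>g\<close> the optimality gap this produces the multiplier of \<open>c\<close>.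
\<close>
lemma finite_dominating_multiple:
  fixes f g :: "'a \<Rightarrow> real"
  assumes "finite V" and "\<And>v. v \<in> V \<Longrightarrow> 0 \<le> g v"
    and "\<And>v. v \<in> V \<Longrightarrow> g v = 0 \<Longrightarrow> f v \<le> 0"
  shows "\<exists>k>0. \<forall>v\<in>V. f v \<le> k * g v"
  using assms
proof (induction V rule: finite_induct)
  case empty
  show ?case by (auto intro: exI[of _ 1])
next
  case (insert x V)
  then obtain k where k: "k > 0" "\<forall>v\<in>V. f v \<le> k * g v" by auto
  define l where "l = max k (f x / g x)"
  have l: "k \<le> l" "f x / g x \<le> l" by (simp_all add: l_def)
  have "f x \<le> l * g x"
  proof (cases "g x = 0")
    case True
    then show ?thesis using insert.prems(2)[of x] by simp
  next
    case False
    then have "g x > 0" using insert.prems(1)[of x] by simp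
    then show ?thesis using l(2) by (simp add: field_simps)
  qed
  moreover have "f v \<le> l * g v" if "v \<in> V" for v
  proof -
    have "f v \<le> k * g v" using k(2) that by blast
    also have "\<dots> \<le> l * g v"
      using l(1) insert.prems(1)[of v] that by (simp add: mult_right_mono)
    finally show ?thesis .
  qed
  ultimately show ?case using k(1) l(1) by (auto intro!: exI[of _ l])
qed

theorem theorem4p4:
  fixes K P F :: "(real ^ 'e) set" and c :: "real ^ 'e" and \<alpha> :: real and I :: "'e set"
  assumes "CARD('e) \<ge> 2"
    and "rational_polyhedral_cone K" and "K \<subseteq> nonneg_orthant"
    and "P = K \<inter> unit_cube"
    and "P = convex hull (P \<inter> zero_one_vectors)"
    and "\<exists>y\<in>P. c \<bullet> y = \<alpha>" and "\<forall>y\<in>P. c \<bullet> y \<le> \<alpha>"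
    and "\<alpha> > 0"
    and "F = {y \<in> P. c \<bullet> y = \<alpha>}"
    and "I = (\<Inter>y\<in>F. supp y)"
  shows "I = (\<Union>u\<in>dual_optimal K c. supp u)"
proof -
  obtain S where K: "K = {x. \<forall>a\<in>S. 0 \<le> a \<bullet> x}"
    using assms(2) by (auto simp: rational_polyhedral_cone_def)
  note P = assms(4) and F = assms(9)
  obtain y0 where y0: "y0 \<in> P" "c \<bullet> y0 = \<alpha>" using assms(6) by blast
  have dual_ge: "\<alpha> \<le> (\<Sum>e\<in>UNIV. u $ e)" if "u \<in> dual_feasible K c" for u
    using weak_duality[OF that, of y0] y0 P by simp
  show ?thesis
  proof (intro equalityI subsetI)
    fix e assume "e \<in> (\<Union>u\<in>dual_optimal K c. supp u)"
    then obtain u where opt: "u \<in> dual_optimal K c" and pos: "0 < u $ e"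
      by (auto simp: supp_def)
    have feas: "u \<in> dual_feasible K c" using opt by (simp add: dual_optimal_def)
    obtain v where "v \<in> dual_feasible K c" "(\<Sum>e\<in>UNIV. v $ e) \<le> \<alpha>"
      using strong_duality[OF K assms(3), of c \<alpha>] assms(7) P by blast
    then have le: "(\<Sum>e\<in>UNIV. u $ e) \<le> \<alpha>"
      using opt by (force simp: dual_optimal_def)
    have "0 < y $ e" if y: "y \<in> F" for y
    proof -
      have yP: "y \<in> K \<inter> unit_cube" and cy: "c \<bullet> y = \<alpha>" using y F P by auto
      have "(\<Sum>e\<in>UNIV. u $ e) \<le> u \<bullet> y"
        using weak_duality(1)[OF feas yP] cy le by simp
      then have "(\<Sum>i\<in>UNIV. u $ i * (1 - y $ i)) \<le> 0"
        by (simp add: inner_sum_coordinates right_diff_distrib sum_subtractf)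
      moreover have nn: "0 \<le> u $ i * (1 - y $ i)" for i
        using feas yP by (auto simp: dual_feasible_def nonneg_orthant_def unit_cube_def)
      ultimately have "(\<Sum>i\<in>UNIV. u $ i * (1 - y $ i)) = 0"
        by (meson order_antisym sum_nonneg)
      then have "u $ e * (1 - y $ e) = 0"
        using nn by (simp add: sum_nonneg_eq_0_iff)
      with pos show ?thesis by simp
    qed
    then show "e \<in> I" using assms(10) by (simp add: supp_def)
  next
    fix e assume "e \<in> I"
    then have e: "0 < y $ e" if "y \<in> F" for y
      using that assms(10) by (auto simp: supp_def)
    have "\<exists>k>0. \<forall>v\<in>P \<inter> zero_one_vectors. 1 - v $ e \<le> k * (\<alpha> - c \<bullet> v)"
    proof (rule finite_dominating_multiple)
      show "finite (P \<inter> zero_one_vectors)"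
        by (simp add: finite_zero_one_vectors)
      fix v assume v: "v \<in> P \<inter> zero_one_vectors"
      then show "0 \<le> \<alpha> - c \<bullet> v" using assms(7) by simp
      assume "\<alpha> - c \<bullet> v = 0"
      then have "0 < v $ e" using e v F by simp
      moreover have "v $ e \<in> {0, 1}" using v by (simp add: zero_one_vectors_def)
      ultimately show "1 - v $ e \<le> 0" by auto
    qed
    then obtain k where k: "k > 0"
      and vert: "\<forall>v\<in>P \<inter> zero_one_vectors. 1 - v $ e \<le> k * (\<alpha> - c \<bullet> v)" by blast
    define q where "q = k *\<^sub>R c - axis e 1"
    have q: "q \<bullet> y = k * (c \<bullet> y) - y $ e" for y
      by (simp add: q_def inner_diff_left inner_axis')
    have "convex hull (P \<inter> zero_one_vectors) \<subseteq> {y. q \<bullet> y \<le> k * \<alpha> - 1}"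
      using vert by (intro hull_minimal convex_halfspace_le) (auto simp: q algebra_simps)
    then have "q \<bullet> y \<le> k * \<alpha> - 1" if "y \<in> K \<inter> unit_cube" for y
      using that assms(5) P by blast
    then obtain w where w: "w \<in> dual_feasible K q" "(\<Sum>i\<in>UNIV. w $ i) \<le> k * \<alpha> - 1"
      using strong_duality[OF K assms(3), of q "k * \<alpha> - 1"] by blast
    define u where "u = (1 / k) *\<^sub>R (w + axis e 1)"
    have w_nonneg: "0 \<le> w $ i" for i
      using w(1) by (simp add: dual_feasible_def nonneg_orthant_def)
    have "u - c = (1 / k) *\<^sub>R (w - q)"
      using k by (simp add: u_def q_def scaleR_add_right scaleR_diff_right)
    moreover have "w - q \<in> dual_cone K" using w(1) by (simp add: dual_feasible_def)
    ultimately have "u - c \<in> dual_cone K"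
      using k by (auto simp: dual_cone_def)
    moreover have "u \<in> nonneg_orthant"
      using w_nonneg k by (simp add: u_def nonneg_orthant_def axis_def)
    ultimately have feas: "u \<in> dual_feasible K c" by (simp add: dual_feasible_def)
    have "(\<Sum>i\<in>UNIV. u $ i) = (1 / k) * ((\<Sum>i\<in>UNIV. w $ i) + 1)"
      by (simp add: u_def sum.distrib axis_def flip: sum_divide_distrib)
    also have "\<dots> \<le> \<alpha>" using w(2) k by (simp add: field_simps)
    finally have "u \<in> dual_optimal K c"
      using feas dual_ge by (force simp: dual_optimal_def)
    moreover have "e \<in> supp u"
      using k w_nonneg[of e] by (simp add: supp_def u_def add_nonneg_pos)
    ultimately show "e \<in> (\<Union>u\<in>dual_optimal K c. supp u)" by blast
  qed
qed

end
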